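(* For every integer $m\ge 1$ it holds that $\mathcal{H}_m=\mathcal{S}_m$, i.e. a matrix $A\in\mathbb{C}^{m\times m}$ is a (non-singular) H-matrix if and only if it is a Sassenfeld matrix.
   Context: For a complex matrix or vector $X$, $|X|$ denotes the matrix or vector of entrywise absolute values; $\operatorname{diag}(X)$ and $\operatorname{off}(X)=X-\operatorname{diag}(X)$ denote the diagonal part and the off-diagonal part of a square matrix $X$. For real matrices or vectors of the same size, $X\succeq Y$ (equivalently $Y\preceq X$) means that all entries of $X-Y$ are non-negative. $\|\cdot\|_\infty$ is the maximum norm on vectors, $I_m$ is the $m\times m$ identity matrix, $\varrho(\cdot)$ is the spectral radius, and $e=(1,\ldots,1)^\top\in\mathbb{R}^m$. Comparison matrix: for $A=[a_{ij}]\in\mathbb{C}^{m\times m}$, $\mathfrak{M}(A):=|\operatorname{diag}(A)|-|\operatorname{off}(A)|\in\mathbb{R}^{m\times m}$, i.e. $\mathfrak{M}(A)_{ii}=|a_{ii}|$ and $\mathfrak{M}(A)_{ij}=-|a_{ij}|$ for $i\neq j$. H-matrices: $\mathcal{H}_m$ is the set of all $A\in\mathbb{C}^{m\times m}$ for which $\mathfrak{M}(A)$ is a non-singular M-matrix, i.e. $\mathfrak{M}(A)=rI_m-B$ for some real matrix $B\succeq 0$ and some real $r>\varrho(B)$. (For $P\in\mathcal{H}_m$ both $P$ and $\mathfrak{M}(P)$ are invertible, and $\mathfrak{M}(P)^{-1}\succeq 0$.) Sassenfeld index: for $A\in\mathbb{C}^{m\times m}$ and $P\in\mathcal{H}_m$,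 put $s(A,P):=\mathfrak{M}(P)^{-1}|A-P|e\in\mathbb{R}^m$ and $\mu(A,P):=\|s(A,P)\|_\infty$. Sassenfeld matrices: $\mathcal{S}_m$ is the set of all $A\in\mathbb{C}^{m\times m}$ for which there exists $P\in\mathcal{H}_m$ with $\mu(A,P)<1$. *)

theory Defs
  imports
    "Jordan_Normal_Form.Gauss_Jordan_Elimination"
    "Jordan_Normal_Form.Spectral_Radius"
begin

definition abs_mat :: "complex mat \<Rightarrow> real mat" where
  "abs_mat A = map_mat cmod A"

definition diag_part :: "'a::zero mat \<Rightarrow> 'a mat" where
  "diag_part A = mat (dim_row A) (dim_col A) (\<lambda>(i, j). if i = j then A $$ (i, j) else 0)"

definition off_part :: "'a::ab_group_add mat \<Rightarrow> 'a mat" where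
  "off_part A = A - diag_part A"

definition comparison_mat :: "complex mat \<Rightarrow> real mat" where
  "comparison_mat A = abs_mat (diag_part A) - abs_mat (off_part A)"

lemma comparison_mat_index:
  assumes "A \<in> carrier_mat m m" "i < m" "j < m"
  shows "comparison_mat A $$ (i, j) = (if i = j then cmod (A $$ (i, j)) else - cmod (A $$ (i, j)))"
  using assms by (auto simp: comparison_mat_def abs_mat_def off_part_def diag_part_def)

lemma comparison_mat_carrier:
  assumes "A \<in> carrier_mat m m"
  shows "comparison_mat A \<in> carrier_mat m m"
  using assms by (auto simp: comparison_mat_def abs_mat_def off_part_def diag_part_def)

text \<open>The library order \<open>\<le>\<close> on matrices is entrywise and requires equal dimensions.\<close>

definition nonsingular_M_matrix :: "nat \<Rightarrow> real mat \<Rightarrow> bool" where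
  "nonsingular_M_matrix m M \<longleftrightarrow>
     (\<exists>B r. B \<in> carrier_mat m m \<and> 0\<^sub>m m m \<le> B \<and>
            spectral_radius (map_mat complex_of_real B) < r \<and>
            M = r \<cdot>\<^sub>m 1\<^sub>m m - B)"

definition H_matrices :: "nat \<Rightarrow> complex mat set" where
  "H_matrices m = {A \<in> carrier_mat m m. nonsingular_M_matrix m (comparison_mat A)}"

text \<open>Only meaningful for vectors of positive dimension.\<close>

definition max_norm :: "real vec \<Rightarrow> real" where
  "max_norm v = Max {\<bar>v $ i\<bar> | i. i < dim_vec v}"

text \<open>The inverse is the library's \<^const>\<open>mat_inverse\<close>, which returns an option: it is
  \<open>Some\<close> of the two-sided inverse exactly for invertible square matrices. The comparison matrix
  of an H-matrix is invertible, so \<^const>\<open>the\<close> is harmless for \<open>P \<in> H_matrices m\<close>, the only case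
  in which the following two functions are used.\<close>

definition sassenfeld_vec :: "complex mat \<Rightarrow> complex mat \<Rightarrow> real vec" where
  "sassenfeld_vec A P =
     the (mat_inverse (comparison_mat P)) *\<^sub>v (abs_mat (A - P) *\<^sub>v vec (dim_col A) (\<lambda>_. 1))"

definition sassenfeld_index :: "complex mat \<Rightarrow> complex mat \<Rightarrow> real" where
  "sassenfeld_index A P = max_norm (sassenfeld_vec A P)"

definition sassenfeld_matrices :: "nat \<Rightarrow> complex mat set" where
  "sassenfeld_matrices m =
     {A \<in> carrier_mat m m. \<exists>P \<in> H_matrices m. sassenfeld_index A P < 1}"

end

theory Submission
  imports Defs
begin

(* The comparison matrix of P in H_m is monotone: if M(P) y is non-negative then so is y, because
   the powers of a non-negative matrix of spectral radius below r are o(r^k).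
   Write M(A) = r I - B with r large and B non-negative. An eigenvector v of B for an eigenvalue of
   modulus at least r satisfies M(A) |v| <= 0. As M(P) <= M(A) + |A - P| entrywise, w = |v|
   satisfies M(P) w <= |A - P| w <= c |A - P| e for c the largest entry of w, hence w <= c s(A, P)
   by monotonicity. All entries of s(A, P) are below 1, so the largest entry of w would be smaller
   than itself. *)

section \<open>Entrywise order and non-negative matrices\<close>

lemma mult_mat_vec_index_sum:
  assumes "A \<in> carrier_mat n n" "v \<in> carrier_vec n" "i < n"
  shows "(A *\<^sub>v v) $ i = (\<Sum>j<n. A $$ (i, j) * v $ j)"
  using assms by (auto simp: scalar_prod_def atLeast0LessThan)

lemma mult_mat_vec_mono:
  fixes C :: "real mat"
  assumes C: "C \<in> carrier_mat n n" "0\<^sub>m n n \<le> C"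
    and xy: "x \<in> carrier_vec n" "x \<le> y"
  shows "C *\<^sub>v x \<le> C *\<^sub>v y"
proof -
  have y: "y \<in> carrier_vec n" using xy by (auto simp: less_eq_vec_def)
  show ?thesis
    unfolding less_eq_vec_def
    using assms y
    by (auto simp: mult_mat_vec_index_sum[of _ n] less_eq_vec_def less_eq_mat_def
        simp del: index_mult_mat_vec intro!: sum_mono mult_left_mono)
qed

lemma nonneg_pow_mat:
  fixes C :: "real mat"
  assumes C: "C \<in> carrier_mat n n" "0\<^sub>m n n \<le> C"
  shows "0\<^sub>m n n \<le> C ^\<^sub>m k"
proof (induction k)
  case 0
  then show ?case using C by (auto simp: less_eq_mat_def)
next
  case (Suc k)
  define X where "X = C ^\<^sub>m k"
  have X: "X \<in> carrier_mat n n" "0\<^sub>m n n \<le> X" using C Suc by (auto simp: X_def)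
  have "0\<^sub>m n n \<le> X * C"
    using C X by (auto simp: less_eq_mat_def scalar_prod_def intro!: sum_nonneg)
  then show ?case by (simp add: X_def)
qed

section \<open>Spectral radius and bounded powers\<close>

lemma spectral_radius_nonneg:
  assumes "A \<in> carrier_mat n n" "n > 0"
  shows "spectral_radius A \<ge> 0"
  using spectral_radius_mem_max(1)[OF assms] by auto

text \<open>An eigenvector of the scaled matrix for \<open>ev\<close> is one of \<open>A\<close> for
  \<open>s * ev\<close>, so \<open>s * cmod ev\<close> is at most the spectral radius of
  \<open>A\<close>, hence below \<open>s\<close>.\<close>

lemma spectral_radius_smult_less:
  assumes A: "A \<in> carrier_mat n n" and n: "n > 0"
    and s: "spectral_radius A < s"
  shows "spectral_radius (inverse (complex_of_real s) \<cdot>\<^sub>m A) < 1"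
proof -
  let ?C = "inverse (complex_of_real s) \<cdot>\<^sub>m A"
  have s0: "s > 0" using spectral_radius_nonneg[OF A n] s by simp
  have C: "?C \<in> carrier_mat n n" using A by simp
  obtain ev v where eq: "spectral_radius ?C = norm ev" and ev: "eigenvector ?C v ev"
    using spectral_radius_mem_max(1)[OF C n] by (auto simp: spectrum_def eigenvalue_def)
  have v: "v \<in> carrier_vec n" "v \<noteq> 0\<^sub>v n" and Cv: "?C *\<^sub>v v = ev \<cdot>\<^sub>v v"
    using ev A by (auto simp: eigenvector_def)
  have "A *\<^sub>v v = (of_real s * ev) \<cdot>\<^sub>v v"
  proof (rule eq_vecI)
    fix i assume "i < dim_vec ((of_real s * ev) \<cdot>\<^sub>v v)"
    then have i: "i < n" using v by simp
    have "(?C *\<^sub>v v) $ i = ev * v $ i" using Cv i v by simp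
    then have "inverse (of_real s) * (A *\<^sub>v v) $ i = ev * v $ i"
      using i v A by (simp add: mult_mat_vec_index_sum[of _ n] sum_distrib_left mult.assoc
          del: index_mult_mat_vec)
    then show "(A *\<^sub>v v) $ i = ((of_real s * ev) \<cdot>\<^sub>v v) $ i"
      using s0 i v by (simp add: field_simps del: index_mult_mat_vec)
  qed (use A v in auto)
  then have "eigenvector A v (of_real s * ev)" using A v by (auto simp: eigenvector_def)
  then have "of_real s * ev \<in> spectrum A" by (auto simp: spectrum_def eigenvalue_def)
  then have "norm (of_real s * ev) \<le> spectral_radius A"
    using spectral_radius_mem_max(2)[OF A n] by blast
  also have "norm (of_real s * ev) = s * norm ev" using s0 by (simp add: norm_mult)
  finally have "s * norm ev < s * 1" using s by linarith
  then show ?thesis using eq mult_less_cancel_left_pos[OF s0] by metis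
qed

text \<open>Scaling brings the spectral radius below 1, where the Jordan normal form bounds all
  powers uniformly. The bound passes back from the complex to the real matrix because the embedding
  commutes with powers and preserves absolute values.\<close>

lemma real_pow_mat_bounded:
  fixes B :: "real mat"
  assumes B: "B \<in> carrier_mat n n" and n: "n > 0"
    and s: "spectral_radius (map_mat complex_of_real B) < s"
  shows "\<exists>c. \<forall>k. norm_bound ((inverse s \<cdot>\<^sub>m B) ^\<^sub>m k) c"
proof -
  let ?C = "inverse s \<cdot>\<^sub>m B"
  have C: "?C \<in> carrier_mat n n" using B by simp
  have hom: "map_mat complex_of_real ?C
      = inverse (complex_of_real s) \<cdot>\<^sub>m map_mat complex_of_real B"
    by (rule eq_matI) auto
  have "spectral_radius (map_mat complex_of_real ?C) < 1"
    unfolding hom by (rule spectral_radius_smult_less[OF _ n s]) (use B in simp)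
  then obtain c where c: "\<And>k. norm_bound ((map_mat complex_of_real ?C) ^\<^sub>m k) c"
    using spectral_radius_jnf_norm_bound_less_1_upper_triangular[of "map_mat complex_of_real ?C" n] C
    by auto
  have "norm_bound (?C ^\<^sub>m k) c" for k
    using c[of k] unfolding of_real_hom.mat_hom_pow[OF C, symmetric] norm_bound_def by simp
  then show ?thesis by blast
qed

section \<open>Monotonicity and invertibility of M-matrices\<close>

lemma nonsingular_M_matrix_carrier:
  "nonsingular_M_matrix n M \<Longrightarrow> M \<in> carrier_mat n n"
  by (auto simp: nonsingular_M_matrix_def)

text \<open>With \<open>M = r I - B\<close>, the hypothesis says that \<open>B y / r\<close> lies
  below \<open>y\<close>. Iterating with the non-negative \<open>B\<close> keeps all
  \<open>B^k y / r^k\<close> below \<open>y\<close>, and these vectors tend to 0.\<close>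

lemma nonsingular_M_matrix_monotone:
  assumes M: "nonsingular_M_matrix n M" and n: "n > 0"
    and y: "y \<in> carrier_vec n" and My: "0\<^sub>v n \<le> M *\<^sub>v y"
  shows "0\<^sub>v n \<le> y"
proof -
  from M obtain B r where B: "B \<in> carrier_mat n n" "0\<^sub>m n n \<le> B"
    and r: "spectral_radius (map_mat complex_of_real B) < r" and eq: "M = r \<cdot>\<^sub>m 1\<^sub>m n - B"
    unfolding nonsingular_M_matrix_def by auto
  \<comment> \<open>The gap up to \<open>r\<close> is split at \<open>s\<close>: dividing
    \<open>B\<close> by \<open>s\<close> keeps its powers bounded, and the remaining factor
    \<open>t = s / r < 1\<close> supplies the decay.\<close>
  obtain s where s: "spectral_radius (map_mat complex_of_real B) < s" "s < r"
    using r dense by blast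
  have "spectral_radius (map_mat complex_of_real B) \<ge> 0"
    by (rule spectral_radius_nonneg[OF _ n]) (use B in simp)
  then have s0: "s > 0" using s by simp
  define t where "t = s / r"
  have t: "0 < t" "t < 1" using s0 s by (auto simp: t_def)
  define C where "C = inverse s \<cdot>\<^sub>m B"
  have C: "C \<in> carrier_mat n n" "0\<^sub>m n n \<le> C"
    using B s0 by (auto simp: C_def less_eq_mat_def)
  obtain c where c: "\<And>k. norm_bound (C ^\<^sub>m k) c"
    using real_pow_mat_bounded[OF B(1) n s(1)] unfolding C_def by blast
  \<comment> \<open>Since \<open>t / s = 1 / r\<close>, this is \<open>B y\<close> below
    \<open>r y\<close>, divided by \<open>r\<close>.\<close>
  have step: "t \<cdot>\<^sub>v (C *\<^sub>v y) \<le> y"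
  proof -
    have "t * (C *\<^sub>v y) $ i \<le> y $ i" if i: "i < n" for i
    proof -
      have "(M *\<^sub>v y) $ i = (\<Sum>j<n. (if i = j then r * y $ j else 0) - B $$ (i, j) * y $ j)"
        unfolding mult_mat_vec_index_sum[OF nonsingular_M_matrix_carrier[OF M] y i]
        using i B by (auto simp: eq algebra_simps intro!: sum.cong)
      also have "\<dots> = r * y $ i - (B *\<^sub>v y) $ i"
        using i y B by (simp add: mult_mat_vec_index_sum[of _ n] sum_subtractf
            del: index_mult_mat_vec)
      finally have "(B *\<^sub>v y) $ i \<le> r * y $ i"
        using My i by (auto simp: less_eq_vec_def)
      moreover have "(C *\<^sub>v y) $ i = (B *\<^sub>v y) $ i / s"
        using i y B unfolding C_def
        by (simp add: mult_mat_vec_index_sum[of _ n] sum_divide_distrib field_simps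
            del: index_mult_mat_vec)
      ultimately show ?thesis using s s0 by (simp add: t_def field_simps del: index_mult_mat_vec)
    qed
    then show ?thesis using y C by (auto simp: less_eq_vec_def)
  qed
  have pow: "t ^ k \<cdot>\<^sub>v (C ^\<^sub>m k *\<^sub>v y) \<le> y" for k
  proof (induction k)
    case 0
    then show ?case using C y by simp
  next
    case (Suc k)
    have Ck: "C ^\<^sub>m k \<in> carrier_mat n n" using C by simp
    have Cy: "C *\<^sub>v y \<in> carrier_vec n" using C y by simp
    \<comment> \<open>The non-negative power of \<open>C\<close> may be applied to both sides of
      \<open>step\<close>.\<close>
    have "C ^\<^sub>m k *\<^sub>v (t \<cdot>\<^sub>v (C *\<^sub>v y)) \<le> C ^\<^sub>m k *\<^sub>v y"
      by (rule mult_mat_vec_mono[OF Ck nonneg_pow_mat[OF C] _ step]) (use Cy in simp)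
    then have "t ^ k \<cdot>\<^sub>v (t \<cdot>\<^sub>v (C ^\<^sub>m k *\<^sub>v (C *\<^sub>v y))) \<le> t ^ k \<cdot>\<^sub>v (C ^\<^sub>m k *\<^sub>v y)"
      using t mult_mat_vec[OF Ck Cy] by (auto simp: less_eq_vec_def)
    also have "\<dots> \<le> y" by (rule Suc)
    finally show ?case
      using assoc_mult_mat_vec[OF Ck C(1) y] by (simp add: smult_smult_assoc mult.commute)
  qed
  have "0 \<le> y $ i" if i: "i < n" for i
  proof -
    \<comment> \<open>\<open>?S\<close> bounds the entries of all \<open>C^k y\<close> in absolute
      value, as \<open>c\<close> is independent of \<open>k\<close>; the factor \<open>t ^ k\<close>
      then sends the lower bound to 0.\<close>
    let ?S = "\<Sum>j<n. c * \<bar>y $ j\<bar>"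
    have "- (t ^ k * ?S) \<le> y $ i" for k
    proof -
      have Ck: "C ^\<^sub>m k \<in> carrier_mat n n" using C by simp
      have "\<bar>(C ^\<^sub>m k *\<^sub>v y) $ i\<bar> \<le> (\<Sum>j<n. \<bar>(C ^\<^sub>m k) $$ (i, j) * y $ j\<bar>)"
        using i y Ck by (simp add: mult_mat_vec_index_sum[of _ n] del: index_mult_mat_vec)
      also have "\<dots> \<le> ?S"
        using c[of k] i C unfolding norm_bound_def
        by (intro sum_mono) (auto simp: abs_mult intro!: mult_right_mono)
      finally have "- ?S \<le> (C ^\<^sub>m k *\<^sub>v y) $ i" by linarith
      then have "t ^ k * - ?S \<le> t ^ k * (C ^\<^sub>m k *\<^sub>v y) $ i"
        using t by (intro mult_left_mono) auto
      also have "\<dots> \<le> y $ i" using pow[of k] i y Ck by (auto simp: less_eq_vec_def)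
      finally show ?thesis by simp
    qed
    moreover have "(\<lambda>k. - (t ^ k * ?S)) \<longlonglongrightarrow> - (0 * ?S)"
      using t by (intro tendsto_intros LIMSEQ_realpow_zero) auto
    ultimately show ?thesis by (intro LIMSEQ_le_const2[of _ "0::real"]) auto
  qed
  then show ?thesis using y by (auto simp: less_eq_vec_def)
qed

text \<open>Monotonicity applied to \<open>v\<close> and to its negative makes the kernel trivial.
  This gives \<open>the\<close> in \<open>sassenfeld_vec\<close> its intended value.\<close>

lemma nonsingular_M_matrix_inverse:
  assumes M: "nonsingular_M_matrix n M" and n: "n > 0"
  obtains N where "mat_inverse M = Some N" "M * N = 1\<^sub>m n" "N \<in> carrier_mat n n"
proof -
  have car: "M \<in> carrier_mat n n" by (rule nonsingular_M_matrix_carrier[OF M])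
  have "v = 0\<^sub>v n" if v: "v \<in> carrier_vec n" "M *\<^sub>v v = 0\<^sub>v n" for v
  proof -
    have "0\<^sub>v n \<le> v"
      by (rule nonsingular_M_matrix_monotone[OF M n v(1)]) (simp add: v)
    moreover have "0\<^sub>v n \<le> (- 1) \<cdot>\<^sub>v v"
      by (rule nonsingular_M_matrix_monotone[OF M n])
        (use v mult_mat_vec[OF car v(1), of "- 1"] in \<open>auto simp: less_eq_vec_def\<close>)
    ultimately show ?thesis using v by (intro eq_vecI) (force simp: less_eq_vec_def)+
  qed
  then have "det M \<noteq> 0" using det_0_iff_vec_prod_zero[OF car] by blast
  then have "M \<in> Units (ring_mat TYPE(real) n ())" by (rule det_non_zero_imp_unit[OF car])
  then obtain N where "mat_inverse M = Some N"
    using mat_inverse(1)[OF car, where b = "()"] by blast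
  then show thesis using that mat_inverse(2)[OF car] by blast
qed

section \<open>Maximum norm and comparison matrices\<close>

lemma abs_le_max_norm:
  assumes "i < dim_vec v"
  shows "\<bar>v $ i\<bar> \<le> max_norm v"
  unfolding max_norm_def using assms by (intro Max_ge) auto

lemma max_norm_less:
  assumes "dim_vec v > 0" "\<And>i. i < dim_vec v \<Longrightarrow> \<bar>v $ i\<bar> < b"
  shows "max_norm v < b"
  unfolding max_norm_def using assms by (subst Max_less_iff) auto

text \<open>If the required splitting failed, the moduli of an eigenvector would form a non-zero,
  non-negative \<open>w\<close> violating \<open>zero\<close>. This criterion avoids any direct
  estimate of a spectral radius.\<close>

lemma nonsingular_M_matrix_comparisonI:
  assumes A: "A \<in> carrier_mat n n" and n: "n > 0"
    and zero: "\<And>w. w \<in> carrier_vec n \<Longrightarrow> 0\<^sub>v n \<le> w \<Longrightarrow>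
      comparison_mat A *\<^sub>v w \<le> 0\<^sub>v n \<Longrightarrow> w = 0\<^sub>v n"
  shows "nonsingular_M_matrix n (comparison_mat A)"
proof -
  \<comment> \<open>Any upper bound of the diagonal moduli makes the diagonal of \<open>B\<close>
    non-negative; the sum is a convenient one. Off the diagonal, \<open>B\<close> has the entries
    \<open>cmod (A $$ (i, j))\<close>.\<close>
  define r where "r = (\<Sum>i<n. cmod (A $$ (i, i)))"
  define B where "B = r \<cdot>\<^sub>m 1\<^sub>m n - comparison_mat A"
  have car: "comparison_mat A \<in> carrier_mat n n" using comparison_mat_carrier[OF A] .
  have B: "B \<in> carrier_mat n n" unfolding B_def by (rule minus_carrier_mat[OF car])
  have "cmod (A $$ (i, i)) \<le> r" if "i < n" for i
    unfolding r_def by (rule member_le_sum) (use that in auto)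
  then have B0: "0\<^sub>m n n \<le> B"
    using car A by (auto simp: B_def less_eq_mat_def comparison_mat_index)
  have "spectral_radius (map_mat complex_of_real B) < r"
  proof (rule ccontr)
    let ?B = "map_mat complex_of_real B"
    assume "\<not> spectral_radius ?B < r"
    moreover have cB: "?B \<in> carrier_mat n n" using B by simp
    \<comment> \<open>\<open>ev\<close> is an eigenvalue of maximal modulus, which is at least
      \<open>r\<close> by assumption.\<close>
    ultimately obtain ev v where ev: "r \<le> cmod ev" "eigenvector ?B v ev"
      using spectral_radius_mem_max(1)[OF cB n] by (auto simp: spectrum_def eigenvalue_def not_less)
    have v: "v \<in> carrier_vec n" "v \<noteq> 0\<^sub>v n" and Bv: "?B *\<^sub>v v = ev \<cdot>\<^sub>v v"
      using ev(2) B by (auto simp: eigenvector_def)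
    define w where "w = map_vec cmod v"
    have w: "w \<in> carrier_vec n" using v by (simp add: w_def)
    have "(comparison_mat A *\<^sub>v w) $ i \<le> 0" if i: "i < n" for i
    proof -
      \<comment> \<open>Taking moduli in row \<open>i\<close> of the eigenvalue equation puts
        \<open>cmod ev * w\<close> below \<open>B w\<close>, which is \<open>r w\<close> minus the
        comparison matrix applied to \<open>w\<close>. As \<open>r\<close> is at most
        \<open>cmod ev\<close>, that last term cannot be positive.\<close>
      have "ev * v $ i = (\<Sum>j<n. of_real (B $$ (i, j)) * v $ j)"
        using arg_cong[OF Bv, of "\<lambda>x. x $ i"] i v B
        by (simp add: mult_mat_vec_index_sum[of _ n] del: index_mult_mat_vec)
      then have "cmod ev * w $ i = cmod (\<Sum>j<n. of_real (B $$ (i, j)) * v $ j)"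
        using i v by (simp add: w_def flip: norm_mult)
      also have "\<dots> \<le> (\<Sum>j<n. B $$ (i, j) * w $ j)"
        by (rule sum_norm_le) (use i v B B0 in \<open>auto simp: w_def norm_mult less_eq_mat_def\<close>)
      also have "\<dots> = (\<Sum>j<n. (if i = j then r * w $ j else 0) - comparison_mat A $$ (i, j) * w $ j)"
        using i car by (auto simp: B_def algebra_simps intro!: sum.cong)
      also have "\<dots> = r * w $ i - (comparison_mat A *\<^sub>v w) $ i"
        using i w car by (simp add: mult_mat_vec_index_sum[of _ n] sum_subtractf
            del: index_mult_mat_vec)
      finally have "cmod ev * w $ i \<le> r * w $ i - (comparison_mat A *\<^sub>v w) $ i" .
      moreover have "r * w $ i \<le> cmod ev * w $ i"
        using ev(1) i v by (intro mult_right_mono) (auto simp: w_def)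
      ultimately show ?thesis by linarith
    qed
    then have "w = 0\<^sub>v n"
      using w v car by (intro zero) (auto simp: less_eq_vec_def w_def)
    then have "v $ i = 0" if "i < n" for i
      using that v index_map_vec(1)[of i v cmod] unfolding w_def by simp
    then have "v = 0\<^sub>v n" using v by (intro eq_vecI) auto
    then show False using v by simp
  qed
  moreover have "comparison_mat A = r \<cdot>\<^sub>m 1\<^sub>m n - B"
    unfolding B_def using car by (intro eq_matI) auto
  ultimately show ?thesis unfolding nonsingular_M_matrix_def using B B0 by blast
qed

lemma comparison_mat_le:
  assumes "A \<in> carrier_mat n n" "P \<in> carrier_mat n n"
  shows "comparison_mat P \<le> comparison_mat A + abs_mat (A - P)"
proof -
  \<comment> \<open>The first inequality serves the diagonal entries, the second the off-diagonal
    ones, where the comparison matrix carries a minus sign.\<close>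
  have "cmod p \<le> cmod a + cmod (a - p)" "cmod a \<le> cmod p + cmod (a - p)" for a p
    using norm_triangle_sub[of p a] norm_triangle_sub[of a p] by (simp_all add: norm_minus_commute)
  then show ?thesis
    using assms comparison_mat_carrier[OF assms(1)] comparison_mat_carrier[OF assms(2)]
    by (auto simp: less_eq_mat_def comparison_mat_index abs_mat_def algebra_simps)
qed

section \<open>The two inclusions\<close>

text \<open>An H-matrix is its own witness: for \<open>P = A\<close> the Sassenfeld vector
  vanishes.\<close>

lemma H_matrix_subset_sassenfeld:
  assumes "n > 0" "A \<in> H_matrices n"
  shows "A \<in> sassenfeld_matrices n"
proof -
  have A: "A \<in> carrier_mat n n" and M: "nonsingular_M_matrix n (comparison_mat A)"
    using assms(2) by (auto simp: H_matrices_def)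
  obtain N where N: "mat_inverse (comparison_mat A) = Some N" "N \<in> carrier_mat n n"
    using nonsingular_M_matrix_inverse[OF M assms(1)] by metis
  have "abs_mat (A - A) *\<^sub>v vec n (\<lambda>_. 1) = 0\<^sub>v n"
    using A by (intro eq_vecI) (auto simp: abs_mat_def scalar_prod_def)
  then have "sassenfeld_vec A A = 0\<^sub>v n"
    using A N by (auto simp: sassenfeld_vec_def scalar_prod_def)
  then have "sassenfeld_index A A < 1"
    unfolding sassenfeld_index_def using assms(1) by (intro max_norm_less) auto
  then show ?thesis using A assms(2) by (auto simp: sassenfeld_matrices_def)
qed

text \<open>The criterion \<open>nonsingular_M_matrix_comparisonI\<close> is verified for
  \<open>A\<close> by means of the monotonicity of the comparison matrix of
  \<open>P\<close>.\<close>

lemma sassenfeld_subset_H_matrix: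
  assumes n: "n > 0" and S: "A \<in> sassenfeld_matrices n"
  shows "A \<in> H_matrices n"
proof -
  obtain P where A: "A \<in> carrier_mat n n" and P: "P \<in> carrier_mat n n"
    and M: "nonsingular_M_matrix n (comparison_mat P)" and less: "sassenfeld_index A P < 1"
    using S by (auto simp: H_matrices_def sassenfeld_matrices_def)
  define D where "D = abs_mat (A - P)"
  define s where "s = sassenfeld_vec A P"
  have D: "D \<in> carrier_mat n n" and D0: "0\<^sub>m n n \<le> D"
    using A P by (auto simp: D_def abs_mat_def less_eq_mat_def)
  have car: "comparison_mat A \<in> carrier_mat n n" "comparison_mat P \<in> carrier_mat n n"
    using A P by (auto intro: comparison_mat_carrier)
  obtain N where N: "mat_inverse (comparison_mat P) = Some N" "comparison_mat P * N = 1\<^sub>m n"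
    "N \<in> carrier_mat n n"
    using nonsingular_M_matrix_inverse[OF M n] .
  define e :: "real vec" where "e = vec n (\<lambda>_. 1)"
  have e: "e \<in> carrier_vec n" by (simp add: e_def)
  have s_eq: "s = N *\<^sub>v (D *\<^sub>v e)"
    using N A by (simp add: s_def sassenfeld_vec_def D_def e_def)
  have s: "s \<in> carrier_vec n" using s_eq N D e by auto
  \<comment> \<open>From here on the inverse enters only through this linear system for
    \<open>s\<close>.\<close>
  have Ms: "comparison_mat P *\<^sub>v s = D *\<^sub>v e"
    unfolding s_eq using assoc_mult_mat_vec[OF car(2) N(3), of "D *\<^sub>v e"] N(2) D e by simp
  have s1: "s $ i < 1" if "i < n" for i
    using abs_le_max_norm[of i s] less that s by (simp add: s_def sassenfeld_index_def)
  have "nonsingular_M_matrix n (comparison_mat A)"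
  proof (rule nonsingular_M_matrix_comparisonI[OF A n])
    fix w assume w: "w \<in> carrier_vec n" and w0: "0\<^sub>v n \<le> w"
      and Aw: "comparison_mat A *\<^sub>v w \<le> 0\<^sub>v n"
    define c where "c = Max ((($) w) ` {..<n})"
    have c: "w $ i \<le> c" if "i < n" for i
      unfolding c_def using that by (intro Max_ge) auto
    have "c \<in> (($) w) ` {..<n}" unfolding c_def using n by (intro Max_in) auto
    \<comment> \<open>The contradiction for \<open>c > 0\<close> will be read off at an index
      \<open>k\<close> where \<open>w\<close> attains its maximum.\<close>
    then obtain k where k: "k < n" "c = w $ k" by auto
    have Pw: "(comparison_mat P *\<^sub>v w) $ i \<le> c * (D *\<^sub>v e) $ i" if i: "i < n" for i
    proof -
      have "(comparison_mat P *\<^sub>v w) $ i = (\<Sum>j<n. comparison_mat P $$ (i, j) * w $ j)"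
        by (rule mult_mat_vec_index_sum[OF car(2) w i])
      \<comment> \<open>The entrywise bound on the comparison matrix of \<open>P\<close> survives
        multiplication by \<open>w\<close> because \<open>w\<close> is non-negative.\<close>
      also have "\<dots> \<le> (\<Sum>j<n. (comparison_mat A $$ (i, j) + D $$ (i, j)) * w $ j)"
        using comparison_mat_le[OF A P] car D w w0 i unfolding D_def[symmetric]
        by (intro sum_mono mult_right_mono) (auto simp: less_eq_mat_def less_eq_vec_def)
      also have "\<dots> = (comparison_mat A *\<^sub>v w) $ i + (\<Sum>j<n. D $$ (i, j) * w $ j)"
        unfolding mult_mat_vec_index_sum[OF car(1) w i] by (simp add: distrib_right sum.distrib)
      also have "\<dots> \<le> (\<Sum>j<n. D $$ (i, j) * w $ j)"
        using Aw i by (auto simp: less_eq_vec_def)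
      also have "\<dots> \<le> (\<Sum>j<n. D $$ (i, j) * c)"
        using c D D0 i by (intro sum_mono mult_left_mono) (auto simp: less_eq_mat_def)
      also have "\<dots> = c * (D *\<^sub>v e) $ i"
        unfolding mult_mat_vec_index_sum[OF D e i]
        by (simp add: e_def sum_distrib_left mult.commute)
      finally show ?thesis .
    qed
    \<comment> \<open>By \<open>Ms\<close> and \<open>Pw\<close>, the comparison matrix of
      \<open>P\<close> maps this difference to a non-negative vector.\<close>
    have "0\<^sub>v n \<le> c \<cdot>\<^sub>v s - w"
    proof (rule nonsingular_M_matrix_monotone[OF M n])
      have "comparison_mat P *\<^sub>v (c \<cdot>\<^sub>v s - w)
          = c \<cdot>\<^sub>v (comparison_mat P *\<^sub>v s) - comparison_mat P *\<^sub>v w"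
        using car s w by (simp add: mult_minus_distrib_mat_vec mult_mat_vec)
      then show "0\<^sub>v n \<le> comparison_mat P *\<^sub>v (c \<cdot>\<^sub>v s - w)"
        unfolding Ms using Pw car D
        by (auto simp: less_eq_vec_def simp del: index_mult_mat_vec)
    qed (use s w in auto)
    then have "w $ k \<le> c * s $ k" using k s w by (auto simp: less_eq_vec_def)
    moreover have "c * s $ k < c * 1" if "c > 0" using that s1[OF k(1)] by simp
    \<comment> \<open>For positive \<open>c\<close>, the entry at \<open>k\<close> would give
      \<open>c <= c * s $ k < c\<close>. With \<open>c\<close> at most 0, the non-negative
      \<open>w\<close> vanishes.\<close>
    ultimately have "c \<le> 0" using k(2) by (metis mult_1_right not_le)
    then show "w = 0\<^sub>v n"
      using c w w0 by (intro eq_vecI) (force simp: less_eq_vec_def intro: antisym order_trans)+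
  qed
  then show ?thesis using A by (simp add: H_matrices_def)
qed

theorem theorem4p4:
  fixes m :: nat
  assumes "m \<ge> 1"
  shows "H_matrices m = sassenfeld_matrices m"
  using assms H_matrix_subset_sassenfeld sassenfeld_subset_H_matrix by auto

end
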